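(* Let $\alpha\in\mathbb{R}$. Let $P_1$ and $P_2$ be two given points contained in $\mathcal{C}^+$ which are collinear with $0=(0,0)$ and such that $0\in S_{12}$, where $S_{12}$ is the segment joining $P_1$ and $P_2$. (1) If $\alpha>-1$, the maximizer of the energy $E_\alpha$ is the segment $S_{12}$. (2) If $\alpha\le -1$, there is not a maximizer of the energy $E_\alpha$ joining both points.
   Context: $\mathbb{L}^2=(\mathbb{R}^2,\langle\cdot,\cdot\rangle)$ with $\langle\cdot,\cdot\rangle=dx^2-dy^2$; $\mathcal{C}=\{p\in\mathbb{L}^2:\langle p,p\rangle=0\}$ is the lightlike cone and $\mathcal{C}^+=\{p\in\mathbb{L}^2:\langle p,p\rangle>0\}$. A smooth regular curve $\gamma$ is spacelike if $\langle\gamma',\gamma'\rangle>0$ everywhere. The energy of a spacelike curve $\gamma$ is $E_\alpha[\gamma]=\int_\gamma|\langle\gamma(s),\gamma(s)\rangle|^{\alpha/2}\,ds$, where $s$ is the arc-length parameter. The problem considered is: given two points $P_1,P_2$, find a spacelike curve joining them which maximizes $E_\alpha$ among all spacelike curves joining $P_1$ and $P_2$; such a curve is called a maximizer. (In the general formulation of the variational problem the curves are assumed not to intersect $\mathcal{C}$; the segment $S_{12}$ of the present statement passes through $0\in\mathcal{C}$.) *)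

theory Defs
  imports "HOL-Analysis.Analysis"
begin

definition lorentz :: "real \<times> real \<Rightarrow> real \<times> real \<Rightarrow> real" where
  "lorentz p q = fst p * fst q - snd p * snd q"

definition cone_plus :: "(real \<times> real) set" where
  "cone_plus = {p. lorentz p p > 0}"

(* C-infinity on the compact interval: D n is the n-th derivative of g, one-sided at a and b. *)
definition smooth_curve :: "real \<Rightarrow> real \<Rightarrow> (real \<Rightarrow> real \<times> real) \<Rightarrow> bool" where
  "smooth_curve a b g \<longleftrightarrow> a < b \<and>
     (\<exists>D :: nat \<Rightarrow> real \<Rightarrow> real \<times> real. D 0 = g \<and>
        (\<forall>n. \<forall>t\<in>{a..b}. (D n has_vector_derivative D (Suc n) t) (at t within {a..b})))"

definition velocity :: "real \<Rightarrow> real \<Rightarrow> (real \<Rightarrow> real \<times> real) \<Rightarrow> real \<Rightarrow> real \<times> real" where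
  "velocity a b g t = vector_derivative g (at t within {a..b})"

(* Regularity (nonvanishing velocity) is implied by the strict inequality. *)
definition spacelike_curve :: "real \<Rightarrow> real \<Rightarrow> (real \<Rightarrow> real \<times> real) \<Rightarrow> bool" where
  "spacelike_curve a b g \<longleftrightarrow> smooth_curve a b g \<and>
     (\<forall>t\<in>{a..b}. lorentz (velocity a b g t) (velocity a b g t) > 0)"

definition spacelike_joining ::
    "real \<times> real \<Rightarrow> real \<times> real \<Rightarrow> real \<Rightarrow> real \<Rightarrow> (real \<Rightarrow> real \<times> real) \<Rightarrow> bool" where
  "spacelike_joining P Q a b g \<longleftrightarrow> spacelike_curve a b g \<and> g a = P \<and> g b = Q"

(* The integral of |<g,g>|^(alpha/2) against the arc-length element ds = sqrt <g',g'> dt,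
   written in an arbitrary regular parameter. Curves may meet the lightlike cone, where the
   integrand is singular for alpha < 0, so the value lies in [0,\<infinity>], with \<infinity>
   for a divergent integral. HOL's convention 0 powr x = 0 affects only a null set of
   parameters: u = x + y and v = x - y are strictly monotone along a spacelike curve, so it
   meets the lightlike cone uv = 0 at most twice. *)
definition energy :: "real \<Rightarrow> real \<Rightarrow> real \<Rightarrow> (real \<Rightarrow> real \<times> real) \<Rightarrow> ennreal" where
  "energy \<alpha> a b g =
     (\<integral>\<^sup>+ t \<in> {a..b}. ennreal (\<bar>lorentz (g t) (g t)\<bar> powr (\<alpha> / 2)
        * sqrt (lorentz (velocity a b g t) (velocity a b g t))) \<partial>lborel)"

(* The maximum must be a finite value: a curve along which the integral diverges is not
   regarded as a maximizer, but it remains a competitor (of energy \<infinity>). *)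
definition maximizer ::
    "real \<Rightarrow> real \<times> real \<Rightarrow> real \<times> real \<Rightarrow> real \<Rightarrow> real \<Rightarrow> (real \<Rightarrow> real \<times> real) \<Rightarrow> bool" where
  "maximizer \<alpha> P Q a b g \<longleftrightarrow>
     spacelike_joining P Q a b g \<and> energy \<alpha> a b g < \<infinity> \<and>
     (\<forall>c d h. spacelike_joining P Q c d h \<longrightarrow> energy \<alpha> c d h \<le> energy \<alpha> a b g)"

end

theory Submission
  imports Defs
begin

text \<open>
  In the null coordinates \<open>x + y\<close> and \<open>x - y\<close> the Lorentz form of a vector is the product of its two
  coordinates. Since \<open>0\<close> lies between the end points, \<open>P2 = - k P1\<close> with \<open>k > 0\<close>. Scaling each null
  coordinate separately, so that both take the value \<open>-1\<close> at \<open>P1\<close>, makes both equal to \<open>k\<close> at \<open>P2\<close>,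
  turns the line through the end points into the diagonal \<open>u = v\<close>, and multiplies the Lorentz form
  by the constant \<open>1 / m\<close>, where \<open>m\<close> is the form at \<open>P1\<close>.
  Being spacelike now means \<open>u' v' > 0\<close>; neither derivative can change sign, and the end values
  force both to be positive. So competitors are pairs of increasing functions running from \<open>-1\<close> to
  \<open>k\<close>, and up to the factor \<open>m powr ((\<alpha> + 1) / 2)\<close> the energy is the integral of the geometric mean
  of \<open>\<bar>u\<bar> powr \<alpha> * u'\<close> and \<open>\<bar>v\<bar> powr \<alpha> * v'\<close> (lemma \<open>energy_null\<close>).

  For \<open>\<alpha> > -1\<close> each of these two functions integrates to the integral \<open>M\<close> of \<open>\<bar>s\<bar> powr \<alpha>\<close> over
  \<open>{-1..k}\<close>, whatever the curve. The arithmetic mean therefore also integrates to \<open>M\<close>, which bounds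
  the energy. In the case of equality the two functions agree almost everywhere, hence so do their
  integrals from the initial point, and thus \<open>u = v\<close> everywhere: the curve runs along the segment
  (lemma \<open>null_energy_le\<close>). Conversely \<open>u = v\<close> holds on the segment, so it attains \<open>M\<close>.

  For \<open>\<alpha> \<le> -1\<close> the same integral along the segment diverges at the origin. The segment is then a
  competitor of infinite energy, and no curve of finite energy can be maximal.
\<close>

section \<open>Integrals of powers of increasing functions\<close>

text \<open>One-sided derivatives at the end points are what a curve on a compact parameter interval
  provides, so the change-of-variable results below are stated for them.\<close>

definition C1_increasing :: "real \<Rightarrow> real \<Rightarrow> (real \<Rightarrow> real) \<Rightarrow> (real \<Rightarrow> real) \<Rightarrow> bool" where
  "C1_increasing a b f f' \<longleftrightarrow> a < b \<and> continuous_on {a..b} f' \<and>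
     (\<forall>t\<in>{a..b}. (f has_real_derivative f' t) (at t within {a..b}) \<and> f' t > 0)"

lemma C1_increasing_continuous:
  assumes "C1_increasing a b f f'"
  shows "continuous_on {a..b} f"
  using assms unfolding C1_increasing_def
  by (intro DERIV_continuous_on[where D = f']) auto

lemma C1_increasing_DERIV:
  assumes "C1_increasing a b f f'" "a < t" "t < b"
  shows "(f has_real_derivative f' t) (at t)" "f' t > 0"
proof -
  have "(f has_real_derivative f' t) (at t within {a..b}) \<and> f' t > 0"
    using assms by (simp add: C1_increasing_def)
  then show "(f has_real_derivative f' t) (at t)" "f' t > 0"
    using assms by (simp_all add: at_within_Icc_at)
qed

lemma C1_increasing_less:
  assumes f: "C1_increasing a b f f'" and "a \<le> s" "s < t" "t \<le> b"
  shows "f s < f t"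
proof (rule DERIV_pos_imp_increasing_open[OF \<open>s < t\<close>])
  fix x assume "s < x" "x < t"
  then show "\<exists>y. (f has_real_derivative y) (at x) \<and> y > 0"
    using C1_increasing_DERIV[OF f, of x] assms by auto
next
  show "continuous_on {s..t} f"
    using C1_increasing_continuous[OF f] assms by (auto elim: continuous_on_subset)
qed

text \<open>A primitive of \<open>\<bar>s\<bar> powr \<alpha>\<close>. It equals \<open>sgn s * \<bar>s\<bar> powr (\<alpha> + 1) / (\<alpha> + 1)\<close>; the form with two
  clipped powers makes continuity and monotonicity across \<open>0\<close> immediate.\<close>

definition power_primitive :: "real \<Rightarrow> real \<Rightarrow> real" where
  "power_primitive \<alpha> s =
     (max s 0 powr (\<alpha> + 1) - max (- s) 0 powr (\<alpha> + 1)) / (\<alpha> + 1)"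

lemma power_primitive_continuous:
  assumes "\<alpha> > -1"
  shows "continuous_on S (power_primitive \<alpha>)"
  unfolding power_primitive_def using assms
  by (auto intro!: continuous_intros continuous_on_powr')

lemma power_primitive_derivative:
  assumes "\<alpha> > -1" "s \<noteq> 0"
  shows "(power_primitive \<alpha> has_real_derivative \<bar>s\<bar> powr \<alpha>) (at s)"
proof (cases "s > 0")
  case True
  have "((\<lambda>s. s powr (\<alpha> + 1) / (\<alpha> + 1)) has_real_derivative \<bar>s\<bar> powr \<alpha>) (at s)"
    using True assms by (auto intro!: derivative_eq_intros)
  then show ?thesis
    by (rule has_field_derivative_transform_within_open[where S = "{0<..}"])
       (use True assms in \<open>auto simp: power_primitive_def\<close>)
next
  case False
  have "((\<lambda>s. - ((- s) powr (\<alpha> + 1)) / (\<alpha> + 1)) has_real_derivative \<bar>s\<bar> powr \<alpha>) (at s)"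
  proof -
    have "((\<lambda>s. (- s) powr (\<alpha> + 1)) has_real_derivative (\<alpha> + 1) * (- s) powr (\<alpha> + 1 - 1) * (- 1)) (at s)"
      using False assms
      by (intro DERIV_chain2[where f = "\<lambda>s. s powr (\<alpha> + 1)"] has_real_derivative_powr DERIV_minus DERIV_ident) auto
    from DERIV_cdivide[OF DERIV_minus[OF this], of "\<alpha> + 1"] show ?thesis
      using False assms by simp
  qed
  then show ?thesis
    by (rule has_field_derivative_transform_within_open[where S = "{..<0}"])
       (use False assms in \<open>auto simp: power_primitive_def\<close>)
qed

lemma power_primitive_less:
  assumes "\<alpha> > -1" "x < y"
  shows "power_primitive \<alpha> x < power_primitive \<alpha> y"
proof -
  have 1: "max x 0 powr (\<alpha> + 1) \<le> max y 0 powr (\<alpha> + 1)"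
    and 2: "max (- y) 0 powr (\<alpha> + 1) \<le> max (- x) 0 powr (\<alpha> + 1)"
    using assms by (auto intro!: powr_mono2)
  have "max x 0 powr (\<alpha> + 1) < max y 0 powr (\<alpha> + 1) \<or>
        max (- y) 0 powr (\<alpha> + 1) < max (- x) 0 powr (\<alpha> + 1)"
  proof (cases "y > 0")
    case True
    then show ?thesis using assms by (auto intro!: powr_less_mono2)
  next
    case False
    have "max (- y) 0 powr (\<alpha> + 1) < max (- x) 0 powr (\<alpha> + 1)"
      using False assms by (intro powr_less_mono2) auto
    then show ?thesis ..
  qed
  with 1 2 have "max x 0 powr (\<alpha> + 1) - max (- x) 0 powr (\<alpha> + 1)
      < max y 0 powr (\<alpha> + 1) - max (- y) 0 powr (\<alpha> + 1)" by linarith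
  then show ?thesis
    using assms unfolding power_primitive_def by (intro divide_strict_right_mono) auto
qed

text \<open>Substitution \<open>s = f x\<close>, through a singularity if \<open>\<alpha> < 0\<close>. An increasing function has at most
  one zero, so the primitive is differentiable along \<open>f\<close> off a finite set and continuous everywhere.
  The fundamental theorem for the Henstock-Kurzweil integral tolerates such exceptions, and for a
  nonnegative integrand its value is the Lebesgue integral.\<close>

lemma nn_integral_power_increasing:
  assumes \<alpha>: "\<alpha> > -1" and f: "C1_increasing a b f f'" and t: "t \<in> {a..b}"
  shows "(\<integral>\<^sup>+ x \<in> {a..t}. ennreal (\<bar>f x\<bar> powr \<alpha> * f' x) \<partial>lborel)
           = ennreal (power_primitive \<alpha> (f t) - power_primitive \<alpha> (f a))"
proof -
  let ?Z = "f -` {0} \<inter> {a..b}"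
  have "x = y" if "x \<in> {a..b}" "y \<in> {a..b}" "f x = f y" for x y
    using C1_increasing_less[OF f, of x y] C1_increasing_less[OF f, of y x] that
    by (cases x y rule: linorder_cases) auto
  then have "inj_on f {a..b}" by (rule inj_onI)
  then have "finite ?Z" by (intro finite_vimage_IntI) auto
  moreover have "((\<lambda>x. power_primitive \<alpha> (f x)) has_vector_derivative \<bar>f x\<bar> powr \<alpha> * f' x) (at x)"
    if "x \<in> {a<..<t} - ?Z" for x
  proof -
    have x: "f x \<noteq> 0" "a < x" "x < b"
      using that t by auto
    from C1_increasing_DERIV(1)[OF f x(2,3)]
    have "(f has_real_derivative f' x) (at x)" .
    from DERIV_chain2[OF power_primitive_derivative[OF \<alpha> x(1)] this] show ?thesis
      by (simp add: has_real_derivative_iff_has_vector_derivative)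
  qed
  moreover have "continuous_on {a..t} (\<lambda>x. power_primitive \<alpha> (f x))"
  proof (rule continuous_on_compose2[OF power_primitive_continuous[OF \<alpha>]])
    show "continuous_on {a..t} f"
      using C1_increasing_continuous[OF f] t by (auto elim: continuous_on_subset)
  qed auto
  ultimately have "((\<lambda>x. \<bar>f x\<bar> powr \<alpha> * f' x) has_integral
      power_primitive \<alpha> (f t) - power_primitive \<alpha> (f a)) {a..t}"
    using t by (intro fundamental_theorem_of_calculus_interior_strong[where S = ?Z]) auto
  from nn_integral_has_integral_lebesgue[OF _ this] f t show ?thesis
    by (subst nn_integral_set_ennreal) (auto simp: C1_increasing_def mult.commute less_imp_le)
qed

section \<open>The energy bound and its equality case\<close>

lemma continuous_on_imp_measurable_restrict_lborel:
  fixes u :: "real \<Rightarrow> real"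
  assumes "continuous_on S u"
  shows "u \<in> borel_measurable (restrict_space lborel S)"
  using borel_measurable_continuous_on_restrict[OF assms]
  by (subst measurable_cong_sets[where M' = "restrict_space borel S" and N' = borel])
     (auto simp: sets_restrict_space)

text \<open>The inequality between geometric and arithmetic mean, integrated. The arithmetic side
  depends only on the common end values of \<open>f\<close> and \<open>g\<close>, and the defect is the integral of a square. If it vanishes, the
  substitution lemma applied on the initial intervals \<open>{a..t}\<close> turns equality almost everywhere of
  the integrands into equality of \<open>f\<close> and \<open>g\<close> at each point.\<close>

lemma null_energy_le:
  assumes \<alpha>: "\<alpha> > -1" and f: "C1_increasing a b f f'" and g: "C1_increasing a b g g'"
    and "f a = g a" and "f b = g b"
  defines "J \<equiv> \<integral>\<^sup>+ t \<in> {a..b}. ennreal (sqrt (\<bar>f t\<bar> powr \<alpha> * f' t)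
                       * sqrt (\<bar>g t\<bar> powr \<alpha> * g' t)) \<partial>lborel"
    and "M \<equiv> ennreal (power_primitive \<alpha> (f b) - power_primitive \<alpha> (f a))"
  shows "J \<le> M"
    and "J = M \<Longrightarrow> t \<in> {a..b} \<Longrightarrow> f t = g t"
proof -
  let ?R = "restrict_space lborel {a..b}"
  define A where "A = (\<lambda>t. \<bar>f t\<bar> powr \<alpha> * f' t)"
  define B where "B = (\<lambda>t. \<bar>g t\<bar> powr \<alpha> * g' t)"
  have pos: "0 \<le> A t" "0 \<le> B t" if "t \<in> {a..b}" for t
    using that f g by (auto simp: A_def B_def C1_increasing_def less_imp_le)
  have ab: "a \<le> b" using f by (simp add: C1_increasing_def)
  have cont: "continuous_on {a..b} f'" "continuous_on {a..b} g'"
    using f g by (auto simp: C1_increasing_def)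
  note meas = continuous_on_imp_measurable_restrict_lborel
  note [measurable] = meas[OF cont(1)] meas[OF cont(2)]
    meas[OF C1_increasing_continuous[OF f]] meas[OF C1_increasing_continuous[OF g]]
  have [measurable]: "A \<in> borel_measurable ?R" "B \<in> borel_measurable ?R"
    unfolding A_def B_def by measurable
  have restr: "(\<integral>\<^sup>+ t. u t \<partial>?R) = (\<integral>\<^sup>+ t \<in> {a..b}. u t \<partial>lborel)" for u
    by (rule nn_integral_restrict_space) auto
  have intA: "(\<integral>\<^sup>+ t. ennreal (A t) \<partial>?R) = M"
    unfolding restr A_def M_def by (rule nn_integral_power_increasing[OF \<alpha> f]) (use ab in auto)
  have intB: "(\<integral>\<^sup>+ t. ennreal (B t) \<partial>?R) = M"
    unfolding restr B_def M_def \<open>f a = g a\<close> \<open>f b = g b\<close>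
    by (rule nn_integral_power_increasing[OF \<alpha> g]) (use ab in auto)
  have J: "J = (\<integral>\<^sup>+ t. ennreal (sqrt (A t) * sqrt (B t)) \<partial>?R)"
    unfolding restr J_def A_def B_def ..
  define D where "D = (\<lambda>t. (sqrt (A t) - sqrt (B t))\<^sup>2)"
  have [measurable]: "D \<in> borel_measurable ?R" unfolding D_def by measurable
  have "ennreal (A t) + ennreal (B t) = 2 * ennreal (sqrt (A t) * sqrt (B t)) + ennreal (D t)"
    if "t \<in> {a..b}" for t
  proof -
    have "A t + B t = 2 * (sqrt (A t) * sqrt (B t)) + D t"
      using pos[OF that] by (simp add: D_def power2_diff)
    then have "ennreal (A t + B t) = ennreal (2 * (sqrt (A t) * sqrt (B t)) + D t)" by simp
    then show ?thesis
      using pos[OF that] by (simp add: ennreal_plus D_def ennreal_mult)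
  qed
  then have "(\<integral>\<^sup>+ t. (ennreal (A t) + ennreal (B t)) \<partial>?R)
      = (\<integral>\<^sup>+ t. (2 * ennreal (sqrt (A t) * sqrt (B t)) + ennreal (D t)) \<partial>?R)"
    by (intro nn_integral_cong) (auto simp: space_restrict_space)
  also have "\<dots> = (\<integral>\<^sup>+ t. 2 * ennreal (sqrt (A t) * sqrt (B t)) \<partial>?R) + (\<integral>\<^sup>+ t. ennreal (D t) \<partial>?R)"
    by (intro nn_integral_add) measurable
  also have "(\<integral>\<^sup>+ t. 2 * ennreal (sqrt (A t) * sqrt (B t)) \<partial>?R) = 2 * J"
    unfolding J by (intro nn_integral_cmult) measurable
  also have "(\<integral>\<^sup>+ t. (ennreal (A t) + ennreal (B t)) \<partial>?R) = 2 * M"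
    by (subst nn_integral_add) (auto simp: intA intB mult_2)
  finally have balance: "2 * M = 2 * J + (\<integral>\<^sup>+ t. ennreal (D t) \<partial>?R)" .
  then have "2 * J \<le> 2 * M" by simp
  then show "J \<le> M"
    by (subst (asm) ennreal_mult_le_mult_iff) auto
  assume "J = M" and t: "t \<in> {a..b}"
  have "2 * M + 0 = 2 * M + (\<integral>\<^sup>+ t. ennreal (D t) \<partial>?R)"
    using balance \<open>J = M\<close> by simp
  moreover have "2 * M \<noteq> top" by (simp add: M_def ennreal_mult_eq_top_iff)
  ultimately have "(\<integral>\<^sup>+ t. ennreal (D t) \<partial>?R) = 0"
    by (metis ennreal_add_left_cancel infinity_ennreal_def)
  then have "AE t in ?R. ennreal (D t) = 0"
    by (subst (asm) nn_integral_0_iff_AE) auto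
  moreover have "A t = B t" if "ennreal (D t) = 0" for t
    using that by (simp add: D_def ennreal_eq_0_iff)
  ultimately have "AE t in ?R. A t = B t" by (auto elim: eventually_mono)
  then have ae: "AE t in lborel. t \<in> {a..b} \<longrightarrow> A t = B t"
    by (subst (asm) AE_restrict_space_iff) auto
  have "(\<integral>\<^sup>+ x \<in> {a..t}. ennreal (A x) \<partial>lborel) = (\<integral>\<^sup>+ x \<in> {a..t}. ennreal (B x) \<partial>lborel)"
    by (rule nn_integral_cong_AE, use ae in eventually_elim) (use t in \<open>auto simp: indicator_def\<close>)
  then have eq: "ennreal (power_primitive \<alpha> (f t) - power_primitive \<alpha> (f a))
      = ennreal (power_primitive \<alpha> (g t) - power_primitive \<alpha> (g a))"
    unfolding A_def B_def nn_integral_power_increasing[OF \<alpha> f t]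
      nn_integral_power_increasing[OF \<alpha> g t] .
  have "power_primitive \<alpha> (u a) \<le> power_primitive \<alpha> (u t)"
    if "C1_increasing a b u u'" for u u'
    using C1_increasing_less[OF that, of a t] power_primitive_less[OF \<alpha>] t
    by (cases "a = t") (auto simp: less_imp_le)
  from this[OF f] this[OF g] have "power_primitive \<alpha> (f t) - power_primitive \<alpha> (f a)
      = power_primitive \<alpha> (g t) - power_primitive \<alpha> (g a)"
    using eq by (simp only: ennreal_inj diff_ge_0_iff_ge)
  then have "power_primitive \<alpha> (f t) = power_primitive \<alpha> (g t)"
    using \<open>f a = g a\<close> by simp
  then show "f t = g t"
    using power_primitive_less[OF \<alpha>, of "f t" "g t"] power_primitive_less[OF \<alpha>, of "g t" "f t"]
    by linarith
qed

section \<open>Divergence for exponents at most -1\<close>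

text \<open>The integrand is \<open>\<bar>s\<bar> powr \<alpha>\<close> on \<open>{-1..k}\<close> after the substitution \<open>s = (1 + k) * t - 1\<close>. For
  \<open>0 < s \<le> 1\<close> it dominates \<open>1 / s\<close>, whose integral over \<open>{c * exp (- n)..c}\<close> is \<open>n\<close>.\<close>

lemma nn_integral_power_diverges:
  assumes \<alpha>: "\<alpha> \<le> -1" and "k > 0"
  shows "(\<integral>\<^sup>+ t \<in> {0..1}. ennreal (\<bar>(1 + k) * t - 1\<bar> powr \<alpha> * (1 + k)) \<partial>lborel) = top"
    (is "?I = _")
proof (rule ccontr)
  assume "?I \<noteq> top"
  then obtain n where n: "?I < of_nat n"
    using ennreal_Ex_less_of_nat by (auto simp: less_top)
  (* On {0<..c} the bound 1 / s \<le> s powr \<alpha> needs s \<le> 1, and s \<le> k keeps t inside {0..1}. *)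
  define c where "c = min 1 k"
  define e where "e = c * exp (- real n)"
  have c: "0 < c" "c \<le> 1" "c \<le> k" using \<open>k > 0\<close> by (auto simp: c_def)
  have e: "0 < e" "e \<le> c" using c by (auto simp: e_def)
  let ?p = "\<lambda>s. (1 + s) / (1 + k)"
  let ?u = "\<lambda>t. (1 + k) * t - 1"
  have u: "?u (?p s) = s" for s using \<open>k > 0\<close> by simp
  have range: "e \<le> ?u t \<and> ?u t \<le> c" if "t \<in> {?p e..?p c}" for t
    using that \<open>k > 0\<close> by (auto simp: field_simps)
  have "((\<lambda>t. (1 + k) / ?u t) has_integral (ln (?u (?p c)) - ln (?u (?p e)))) {?p e..?p c}"
  proof (rule fundamental_theorem_of_calculus)
    show "?p e \<le> ?p c" using e \<open>k > 0\<close> by (intro divide_right_mono) auto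
    fix t assume "t \<in> {?p e..?p c}"
    from range[OF this] e have "?u t > 0" by linarith
    then have "((\<lambda>t. ln (?u t)) has_real_derivative (1 + k) / ?u t) (at t within {?p e..?p c})"
      by (auto intro!: derivative_eq_intros simp: field_simps)
    then show "((\<lambda>t. ln (?u t)) has_vector_derivative (1 + k) / ?u t) (at t within {?p e..?p c})"
      by (simp add: has_real_derivative_iff_has_vector_derivative)
  qed
  moreover have "ln (?u (?p c)) - ln (?u (?p e)) = real n"
    unfolding u using c by (simp add: e_def ln_mult)
  ultimately have hi: "((\<lambda>t. (1 + k) / ?u t) has_integral real n) {?p e..?p c}" by simp
  have nonneg: "0 \<le> (1 + k) / ?u t" if "t \<in> {?p e..?p c}" for t
    using range[OF that] e \<open>k > 0\<close> by auto
  have "of_nat n = ennreal (real n)" by (simp add: ennreal_of_nat_eq_real_of_nat)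
  also have "\<dots> = (\<integral>\<^sup>+ t. ennreal (indicator {?p e..?p c} t * ((1 + k) / ?u t)) \<partial>lborel)"
    using nn_integral_has_integral_lebesgue[OF nonneg hi] by simp
  also have "\<dots> \<le> ?I"
  proof (rule nn_integral_mono)
    fix t
    show "ennreal (indicator {?p e..?p c} t * ((1 + k) / ?u t))
        \<le> ennreal (\<bar>?u t\<bar> powr \<alpha> * (1 + k)) * indicator {0..1} t"
    proof (cases "t \<in> {?p e..?p c}")
      case True
      from range[OF True] have ut: "0 < ?u t" "?u t \<le> 1" "?u t \<le> k" using c e by auto
      have "0 < (1 + k) * t" using ut(1) by linarith
      then have "0 \<le> t" using \<open>k > 0\<close> by (simp add: zero_less_mult_iff)
      have "(1 + k) * t \<le> (1 + k) * 1" using ut(3) by simp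
      then have "t \<le> 1" using \<open>k > 0\<close> by (subst (asm) mult_le_cancel_left_pos) auto
      have "1 / ?u t = ?u t powr (-1)"
        using ut by (simp add: powr_minus_divide)
      also have "\<dots> \<le> ?u t powr \<alpha>"
        using ut \<alpha> by (intro powr_mono') auto
      finally have "1 / ?u t * (1 + k) \<le> ?u t powr \<alpha> * (1 + k)"
        using \<open>k > 0\<close> by (intro mult_right_mono) auto
      then show ?thesis using True ut \<open>0 \<le> t\<close> \<open>t \<le> 1\<close> by (auto intro!: ennreal_leI)
    qed auto
  qed
  finally show False using n by simp
qed

section \<open>Normalised null coordinates\<close>

text \<open>The sign and the denominators make both coordinates equal to \<open>-1\<close> at \<open>P\<close>, so that a curve
  from \<open>P\<close> through to the opposite ray has increasing coordinates in whichever component of the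
  spacelike cone \<open>P\<close> lies.\<close>

definition null_plus :: "real \<times> real \<Rightarrow> real \<times> real \<Rightarrow> real" where
  "null_plus P p = - (fst p + snd p) / (fst P + snd P)"

definition null_minus :: "real \<times> real \<Rightarrow> real \<times> real \<Rightarrow> real" where
  "null_minus P p = - (fst p - snd p) / (fst P - snd P)"

lemma bounded_linear_null: "bounded_linear (null_plus P)" "bounded_linear (null_minus P)"
proof -
  have "null_plus P = (\<lambda>p. (fst p + snd p) * (- 1 / (fst P + snd P)))"
    "null_minus P = (\<lambda>p. (fst p - snd p) * (- 1 / (fst P - snd P)))"
    by (auto simp: null_plus_def null_minus_def fun_eq_iff divide_inverse
        simp del: minus_add_distrib minus_diff_eq)
  moreover have "bounded_linear (\<lambda>p. (fst p + snd p) * (- 1 / (fst P + snd P)))"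
    "bounded_linear (\<lambda>p. (fst p - snd p) * (- 1 / (fst P - snd P)))"
    by (intro bounded_linear_mult_const bounded_linear_add bounded_linear_sub
        bounded_linear_fst bounded_linear_snd)+
  ultimately show "bounded_linear (null_plus P)" "bounded_linear (null_minus P)" by metis+
qed

lemma lorentz_factor: "lorentz p p = (fst p + snd p) * (fst p - snd p)"
  by (simp add: lorentz_def algebra_simps)

lemma cone_plus_null_nonzero:
  assumes "lorentz P P > 0"
  shows "fst P + snd P \<noteq> 0" "fst P - snd P \<noteq> 0"
  using assms by (auto simp: lorentz_factor)

lemma lorentz_eq_null:
  assumes "lorentz P P > 0"
  shows "lorentz p p = lorentz P P * (null_plus P p * null_minus P p)"
  using cone_plus_null_nonzero[OF assms]
  by (simp add: lorentz_factor null_plus_def null_minus_def) algebra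

lemma null_scaleR:
  assumes "lorentz P P > 0"
  shows "null_plus P (r *\<^sub>R P) = - r" "null_minus P (r *\<^sub>R P) = - r"
  using cone_plus_null_nonzero[OF assms]
  by (auto simp: null_plus_def null_minus_def field_simps)

lemma null_eq_imp_on_line:
  assumes "lorentz P P > 0" "null_plus P p = null_minus P p"
  shows "p = (- null_plus P p) *\<^sub>R P"
proof -
  define r where "r = - null_plus P p"
  have "fst p + snd p = r * (fst P + snd P)" "fst p - snd p = r * (fst P - snd P)"
    using cone_plus_null_nonzero[OF assms(1)] assms(2)
    by (auto simp: r_def null_plus_def null_minus_def field_simps)
  then have "fst p = r * fst P" "snd p = r * snd P" by (auto simp: algebra_simps)
  then show ?thesis unfolding r_def[symmetric] by (simp add: prod_eq_iff)
qed

section \<open>Spacelike curves in null coordinates\<close>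

lemma smooth_curve_velocity:
  assumes "smooth_curve a b g"
  shows "a < b" "continuous_on {a..b} (velocity a b g)"
    "t \<in> {a..b} \<Longrightarrow> (g has_vector_derivative velocity a b g t) (at t within {a..b})"
    "continuous_on {a..b} g"
proof -
  from assms obtain D where ab: "a < b" and D0: "D 0 = g"
    and D: "\<And>n t. t \<in> {a..b} \<Longrightarrow> (D n has_vector_derivative D (Suc n) t) (at t within {a..b})"
    unfolding smooth_curve_def by blast
  have vel: "velocity a b g t = D 1 t" if "t \<in> {a..b}" for t
    using vector_derivative_within_closed_interval[OF ab that D[OF that, of 0]]
    by (simp add: velocity_def D0)
  show "a < b" by fact
  have cont: "continuous_on {a..b} (D n)" for n
    using has_vector_derivative_continuous[OF D[of _ n]]
    by (simp add: continuous_on_eq_continuous_within)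
  from cont[of 0] show "continuous_on {a..b} g" by (simp add: D0)
  from cont[of 1] show "continuous_on {a..b} (velocity a b g)"
    by (subst continuous_on_cong[OF refl vel])
  show "(g has_vector_derivative velocity a b g t) (at t within {a..b})" if "t \<in> {a..b}"
    using D[OF that, of 0] vel[OF that] by (simp add: D0)
qed

text \<open>The derivative is positive somewhere by the mean value theorem, and by connectedness it
  cannot become negative without vanishing.\<close>

lemma nonvanishing_derivative_pos:
  fixes f :: "real \<Rightarrow> real"
  assumes ab: "a < b" and "continuous_on {a..b} f'"
    and der: "\<And>t. t \<in> {a..b} \<Longrightarrow> (f has_real_derivative f' t) (at t within {a..b})"
    and nz: "\<And>t. t \<in> {a..b} \<Longrightarrow> f' t \<noteq> 0" and "f a < f b"
  shows "C1_increasing a b f f'"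
proof -
  have "\<exists>x\<in>{a<..<b}. f b - f a = f' x * (b - a)"
    using mvt_simple[OF ab, of f "\<lambda>x h. f' x * h"] der
    by (auto simp: has_field_derivative_def)
  then obtain x where x: "x \<in> {a..b}" "f b - f a = f' x * (b - a)"
    by (meson greaterThanLessThan_subseteq_atLeastAtMost_iff order_refl subsetD)
  then have "f' x > 0"
    using \<open>f a < f b\<close> ab by (metis diff_gt_0_iff_gt zero_less_mult_pos2)
  have "connected (f' ` {a..b})"
    by (rule connected_continuous_image) (use assms in auto)
  then have "f' t > 0" if "t \<in> {a..b}" for t
    using connectedD_interval[of "f' ` {a..b}" "f' t" "f' x" 0] that x(1) \<open>f' x > 0\<close> nz
    by fastforce
  with assms show ?thesis by (auto simp: C1_increasing_def)
qed

text \<open>The product of the two coordinates of the velocity is positive, so neither vanishes, and each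
  coordinate grows from \<open>-1\<close> to \<open>k\<close>. Both satisfy the same three hypotheses, hence the common
  argument for a linear functional \<open>N\<close> with \<open>N (r *\<^sub>R P) = - r\<close>.\<close>

lemma spacelike_joining_null_increasing:
  assumes P: "lorentz P P > 0" and "k > 0"
    and g: "spacelike_joining P ((- k) *\<^sub>R P) a b g"
  shows "C1_increasing a b (null_plus P \<circ> g) (null_plus P \<circ> velocity a b g)"
    and "C1_increasing a b (null_minus P \<circ> g) (null_minus P \<circ> velocity a b g)"
proof -
  have sm: "smooth_curve a b g" and ends: "g a = 1 *\<^sub>R P" "g b = (- k) *\<^sub>R P"
    and sp: "\<And>t. t \<in> {a..b} \<Longrightarrow> lorentz (velocity a b g t) (velocity a b g t) > 0"
    using g by (auto simp: spacelike_joining_def spacelike_curve_def)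
  have nz: "null_plus P (velocity a b g t) \<noteq> 0" "null_minus P (velocity a b g t) \<noteq> 0"
    if "t \<in> {a..b}" for t
    using sp[OF that] by (auto simp: lorentz_eq_null[OF P, of "velocity a b g t"])
  have "C1_increasing a b (N \<circ> g) (N \<circ> velocity a b g)"
    if N: "bounded_linear N" and "\<And>t. t \<in> {a..b} \<Longrightarrow> N (velocity a b g t) \<noteq> 0"
      and "\<And>r. N (r *\<^sub>R P) = - r" for N :: "real \<times> real \<Rightarrow> real"
  proof (rule nonvanishing_derivative_pos)
    show "continuous_on {a..b} (N \<circ> velocity a b g)"
      using smooth_curve_velocity(2)[OF sm] bounded_linear.continuous_on[OF N]
      by (simp add: comp_def)
    show "((N \<circ> g) has_real_derivative (N \<circ> velocity a b g) t) (at t within {a..b})"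
      if "t \<in> {a..b}" for t
      using bounded_linear.has_vector_derivative[OF N smooth_curve_velocity(3)[OF sm that]]
      by (simp add: comp_def has_real_derivative_iff_has_vector_derivative)
    show "(N \<circ> g) a < (N \<circ> g) b"
      unfolding comp_def ends that(3) using \<open>k > 0\<close> by simp
  qed (use that smooth_curve_velocity(1)[OF sm] in auto)
  from this[OF bounded_linear_null(1) nz(1) null_scaleR(1)[OF P]]
    this[OF bounded_linear_null(2) nz(2) null_scaleR(2)[OF P]]
  show "C1_increasing a b (null_plus P \<circ> g) (null_plus P \<circ> velocity a b g)"
    and "C1_increasing a b (null_minus P \<circ> g) (null_minus P \<circ> velocity a b g)"
    by blast+
qed

text \<open>The constant collects \<open>m powr (\<alpha> / 2)\<close> from the weight and \<open>sqrt m\<close> from the arc-length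
  element, with \<open>m = lorentz P P\<close>. The real \<open>sqrt\<close> is odd and
  multiplicative on all reals, so the root of the product splits whatever the signs of the factors.
  Smoothness makes the integrand measurable, as pulling out the constant requires.\<close>

lemma energy_null:
  assumes P: "lorentz P P > 0" and g: "smooth_curve a b g"
  shows "energy \<alpha> a b g = ennreal (lorentz P P powr ((\<alpha> + 1) / 2)) *
    (\<integral>\<^sup>+ t \<in> {a..b}. ennreal (sqrt (\<bar>null_plus P (g t)\<bar> powr \<alpha> * null_plus P (velocity a b g t))
       * sqrt (\<bar>null_minus P (g t)\<bar> powr \<alpha> * null_minus P (velocity a b g t))) \<partial>lborel)"
proof -
  let ?m = "lorentz P P"
  have pt: "\<bar>?m * (u * v)\<bar> powr (\<alpha> / 2) * sqrt (?m * (u' * v'))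
      = ?m powr ((\<alpha> + 1) / 2) * (sqrt (\<bar>u\<bar> powr \<alpha> * u') * sqrt (\<bar>v\<bar> powr \<alpha> * v'))"
    for u v u' v' :: real
  proof -
    have "\<bar>?m * (u * v)\<bar> powr (\<alpha> / 2) = ?m powr (\<alpha> / 2) * (sqrt (\<bar>u\<bar> powr \<alpha>) * sqrt (\<bar>v\<bar> powr \<alpha>))"
      using P by (simp add: abs_mult powr_mult powr_half_sqrt_powr)
    moreover have "?m powr ((\<alpha> + 1) / 2) = ?m powr (\<alpha> / 2) * sqrt ?m"
      using P by (simp add: add_divide_distrib powr_add powr_half_sqrt)
    ultimately show ?thesis by (simp add: real_sqrt_mult mult_ac)
  qed
  let ?j = "\<lambda>t. sqrt (\<bar>null_plus P (g t)\<bar> powr \<alpha> * null_plus P (velocity a b g t))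
       * sqrt (\<bar>null_minus P (g t)\<bar> powr \<alpha> * null_minus P (velocity a b g t))"
  let ?R = "restrict_space lborel {a..b}"
  have *: "(\<lambda>t. N (g t)) \<in> borel_measurable ?R"
      "(\<lambda>t. N (velocity a b g t)) \<in> borel_measurable ?R"
    if "bounded_linear N" for N :: "real \<times> real \<Rightarrow> real"
    by (auto intro!: continuous_on_imp_measurable_restrict_lborel
        bounded_linear.continuous_on[OF that] smooth_curve_velocity[OF g])
  note [measurable] = *[OF bounded_linear_null(1)] *[OF bounded_linear_null(2)]
  have restr: "(\<integral>\<^sup>+ t. u t \<partial>?R) = (\<integral>\<^sup>+ t \<in> {a..b}. u t \<partial>lborel)" for u
    by (rule nn_integral_restrict_space) auto
  have "energy \<alpha> a b g = (\<integral>\<^sup>+ t. ennreal (?m powr ((\<alpha> + 1) / 2)) * ennreal (?j t) \<partial>?R)"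
    unfolding energy_def restr
      lorentz_eq_null[OF P, of "g _"] lorentz_eq_null[OF P, of "velocity _ _ _ _"] pt
    by (simp add: ennreal_mult')
  also have "\<dots> = ennreal (?m powr ((\<alpha> + 1) / 2)) * (\<integral>\<^sup>+ t. ennreal (?j t) \<partial>?R)"
    by (intro nn_integral_cmult) measurable
  finally show ?thesis unfolding restr .
qed

section \<open>The segment through the origin\<close>

lemma linepath_antipodal_spacelike:
  assumes P: "lorentz P P > 0" and "k > 0"
  shows "spacelike_joining P ((- k) *\<^sub>R P) 0 1 (linepath P ((- k) *\<^sub>R P))"
    and "t \<in> {0..1} \<Longrightarrow> velocity 0 1 (linepath P ((- k) *\<^sub>R P)) t = (- (1 + k)) *\<^sub>R P"
proof -
  let ?l = "linepath P ((- k) *\<^sub>R P)"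
  define D where "D n = (if n = 0 then ?l else if n = 1 then (\<lambda>_. (- (1 + k)) *\<^sub>R P) else (\<lambda>_. 0))"
    for n :: nat
  have D: "(D n has_vector_derivative D (Suc n) t) (at t within S)" for n t S
    unfolding D_def linepath_def
    by (auto intro!: derivative_eq_intros simp: algebra_simps)
  have vel: "velocity 0 1 ?l t = (- (1 + k)) *\<^sub>R P" if "t \<in> {0..1}" for t
    using vector_derivative_within_closed_interval[OF _ that D[of 0]]
    by (simp add: velocity_def D_def)
  show "t \<in> {0..1} \<Longrightarrow> velocity 0 1 ?l t = (- (1 + k)) *\<^sub>R P" by (rule vel)
  have "smooth_curve 0 1 ?l"
    unfolding smooth_curve_def by (auto intro!: exI[of _ D] D simp: D_def[of 0])
  moreover have "lorentz (velocity 0 1 ?l t) (velocity 0 1 ?l t) > 0" if "t \<in> {0..1}" for t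
    unfolding vel[OF that] lorentz_eq_null[OF P, of "_ *\<^sub>R P"] null_scaleR[OF P]
    using P \<open>k > 0\<close> by simp
  ultimately show "spacelike_joining P ((- k) *\<^sub>R P) 0 1 ?l"
    unfolding spacelike_joining_def spacelike_curve_def
    by (intro conjI ballI) (simp_all only: linepath_0' linepath_1')
qed

lemma energy_linepath_antipodal:
  assumes P: "lorentz P P > 0" and "k > 0"
  shows "energy \<alpha> 0 1 (linepath P ((- k) *\<^sub>R P)) = ennreal (lorentz P P powr ((\<alpha> + 1) / 2)) *
    (\<integral>\<^sup>+ t \<in> {0..1}. ennreal (\<bar>(1 + k) * t - 1\<bar> powr \<alpha> * (1 + k)) \<partial>lborel)"
proof -
  let ?l = "linepath P ((- k) *\<^sub>R P)"
  have l: "?l t = (1 - (1 + k) * t) *\<^sub>R P" for t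
    by (simp add: linepath_def algebra_simps)
  have smooth: "smooth_curve 0 1 ?l"
    using linepath_antipodal_spacelike(1)[OF assms]
    by (simp add: spacelike_joining_def spacelike_curve_def)
  have "sqrt (\<bar>null_plus P (?l t)\<bar> powr \<alpha> * null_plus P (velocity 0 1 ?l t))
      * sqrt (\<bar>null_minus P (?l t)\<bar> powr \<alpha> * null_minus P (velocity 0 1 ?l t))
      = \<bar>(1 + k) * t - 1\<bar> powr \<alpha> * (1 + k)" if "t \<in> {0..1}" for t
    unfolding linepath_antipodal_spacelike(2)[OF assms that] l null_scaleR[OF P]
    using \<open>k > 0\<close> by simp
  then show ?thesis
    unfolding energy_null[OF P smooth]
    by (intro arg_cong[where f = "(*) _"] nn_integral_cong)
       (simp split: split_indicator del: scaleR_minus_left)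
qed

lemma closed_segment_antipodal:
  fixes P :: "'a :: real_vector"
  assumes "k > 0"
  shows "closed_segment P ((- k) *\<^sub>R P) = (\<lambda>s. (- s) *\<^sub>R P) ` {-1..k}"
proof -
  have "closed_segment P ((- k) *\<^sub>R P) = (\<lambda>s. (- s) *\<^sub>R P) ` closed_segment (-1) k"
    using closed_segment_linear_image[of "\<lambda>s. (- s) *\<^sub>R P" "-1" k]
    by (simp add: linear_iff algebra_simps)
  then show ?thesis using assms by (simp add: closed_segment_eq_real_ivl)
qed

section \<open>Maximizers between opposite points\<close>

theorem theorem5p2:
  fixes \<alpha> :: real and P1 P2 :: "real \<times> real"
  assumes "P1 \<in> cone_plus" and "P2 \<in> cone_plus"
    and "collinear {0, P1, P2}"
    and "0 \<in> closed_segment P1 P2"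
  shows "(\<alpha> > -1 \<longrightarrow>
            maximizer \<alpha> P1 P2 0 1 (linepath P1 P2) \<and>
            (\<forall>a b g. maximizer \<alpha> P1 P2 a b g \<longrightarrow> g ` {a..b} = closed_segment P1 P2))
       \<and> (\<alpha> \<le> -1 \<longrightarrow> \<not> (\<exists>a b g. maximizer \<alpha> P1 P2 a b g))"
proof -
  have P: "lorentz P1 P1 > 0" and nz: "P1 \<noteq> 0" "P2 \<noteq> 0"
    using assms(1,2) by (auto simp: cone_plus_def lorentz_def)
  obtain t where t: "0 \<le> t" "t \<le> 1" "(1 - t) *\<^sub>R P1 + t *\<^sub>R P2 = 0"
    using assms(4) by (auto simp: closed_segment_def)
  have "t \<noteq> 0" "t \<noteq> 1" using t(3) nz by auto
  define k where "k = (1 - t) / t"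
  have k: "k > 0" using t \<open>t \<noteq> 0\<close> \<open>t \<noteq> 1\<close> by (simp add: k_def)
  have "t *\<^sub>R P2 = (- (1 - t)) *\<^sub>R P1"
    using t(3) by (metis add.commute eq_neg_iff_add_eq_0 scaleR_minus_left)
  then have "(1 / t) *\<^sub>R (t *\<^sub>R P2) = (1 / t) *\<^sub>R ((- (1 - t)) *\<^sub>R P1)" by simp
  then have P2: "P2 = (- k) *\<^sub>R P1"
    using \<open>t \<noteq> 0\<close> by (simp add: k_def minus_divide_left flip: scaleR_minus_left)
  let ?l = "linepath P1 P2"
  let ?c = "ennreal (lorentz P1 P1 powr ((\<alpha> + 1) / 2))"
  have c: "?c \<noteq> 0" "?c \<noteq> top" using P by auto
  have l: "spacelike_joining P1 P2 0 1 ?l"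
    unfolding P2 by (rule linepath_antipodal_spacelike(1)[OF P k])
  have "\<not> maximizer \<alpha> P1 P2 a b g" if "\<alpha> \<le> -1" for a b g
  proof -
    have "energy \<alpha> 0 1 ?l = top"
      unfolding P2 energy_linepath_antipodal[OF P k] nn_integral_power_diverges[OF that k]
      using c by (simp add: ennreal_mult_top)
    then show ?thesis using l by (fastforce simp: maximizer_def)
  qed
  moreover have "maximizer \<alpha> P1 P2 0 1 ?l \<and>
      (\<forall>a b g. maximizer \<alpha> P1 P2 a b g \<longrightarrow> g ` {a..b} = closed_segment P1 P2)" if \<alpha>: "\<alpha> > -1"
  proof -
    define M where "M = ennreal (power_primitive \<alpha> k - power_primitive \<alpha> (-1))"
    have el: "energy \<alpha> 0 1 ?l = ?c * M"
    proof -
      have "C1_increasing 0 1 (\<lambda>t. (1 + k) * t - 1) (\<lambda>_. 1 + k)"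
        using k by (auto simp: C1_increasing_def intro!: derivative_eq_intros)
      from nn_integral_power_increasing[OF \<alpha> this, of 1] show ?thesis
        unfolding P2 energy_linepath_antipodal[OF P k] M_def by simp
    qed
    have bound: "energy \<alpha> a b g \<le> ?c * M" "energy \<alpha> a b g = ?c * M \<Longrightarrow> g ` {a..b} = closed_segment P1 P2"
      if g: "spacelike_joining P1 P2 a b g" for a b g
    proof -
      let ?u = "null_plus P1 \<circ> g" and ?v = "null_minus P1 \<circ> g"
      note inc = spacelike_joining_null_increasing[OF P k g[unfolded P2]]
      have "g a = 1 *\<^sub>R P1" "g b = (- k) *\<^sub>R P1" and "a < b" and sm: "smooth_curve a b g"
        using g by (auto simp: spacelike_joining_def P2 spacelike_curve_def smooth_curve_def)
      then have ends: "?u a = -1" "?v a = -1" "?u b = k" "?v b = k"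
        by (simp_all only: comp_def null_scaleR[OF P] minus_minus)
      note J = null_energy_le[OF \<alpha> inc, unfolded ends, OF refl refl,
          folded M_def, unfolded comp_def]
      show "energy \<alpha> a b g \<le> ?c * M"
        unfolding energy_null[OF P sm] by (intro mult_left_mono J(1)) auto
      assume "energy \<alpha> a b g = ?c * M"
      then have "?u t = ?v t" if "t \<in> {a..b}" for t
        using J(2)[OF _ that] c that unfolding energy_null[OF P sm]
        by (auto simp: ennreal_mult_cancel_left comp_def)
      then have "g t = (- ?u t) *\<^sub>R P1" if "t \<in> {a..b}" for t
        using that null_eq_imp_on_line[OF P, of "g t"] by auto
      then have "g ` {a..b} = (\<lambda>s. (- s) *\<^sub>R P1) ` (?u ` {a..b})"
        by (force simp: image_image)
      also have "?u ` {a..b} = {-1..k}"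
      proof (intro equalityI subsetI)
        fix s assume "s \<in> ?u ` {a..b}"
        then obtain t where "t \<in> {a..b}" "s = ?u t" by auto
        then show "s \<in> {-1..k}"
          using C1_increasing_less[OF inc(1), of a t] C1_increasing_less[OF inc(1), of t b] ends
          by (cases "t = a"; cases "t = b") auto
      next
        fix s assume "s \<in> {-1..k}"
        then show "s \<in> ?u ` {a..b}"
          using IVT'[of ?u a s b] C1_increasing_continuous[OF inc(1)] ends \<open>a < b\<close> by force
      qed
      finally show "g ` {a..b} = closed_segment P1 P2"
        unfolding P2 closed_segment_antipodal[OF k] .
    qed
    have "maximizer \<alpha> P1 P2 0 1 ?l"
      using l bound(1) c unfolding maximizer_def el by (auto simp: M_def ennreal_mult_less_top less_top)
    moreover have "g ` {a..b} = closed_segment P1 P2" if g: "maximizer \<alpha> P1 P2 a b g" for a b g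
    proof -
      have "spacelike_joining P1 P2 a b g" "?c * M \<le> energy \<alpha> a b g"
        using g l unfolding maximizer_def el[symmetric] by blast+
      with bound(1) show ?thesis by (intro bound(2) antisym)
    qed
    ultimately show ?thesis by blast
  qed
  ultimately show ?thesis by blast
qed

end
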